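(* Let $\mathcal{X}$ be a Banach space and let $K\subset\mathcal{X}$ be an absolutely convex infinite-dimensional compact set. Then $\mathcal{A}_K\subset WG(K)$.
   Context: $\mathcal{L}(\mathcal{X})$ is the space of bounded linear operators on $\mathcal{X}$. $G(K)=\{D\in\mathcal{L}(\mathcal{X}): DK\supset K\}$, and $WG(K)$ is the closure of $G(K)$ in the weak operator topology of $\mathcal{L}(\mathcal{X})$. $V_K=\overline{\mathrm{lin}(K)}$ is the norm-closed linear span of $K$, and $\mathcal{A}_K=\{T\in\mathcal{L}(\mathcal{X}): TV_K\subset V_K\}$. "Infinite-dimensional" means that the linear span $\mathrm{lin}(K)$ is infinite-dimensional. *)

theory Defs
  imports "HOL-Analysis.Analysis"
begin

text \<open>
  A Banach space over a scalar field \<open>'k\<close> (below: the reals or the complex numbers). The class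
  \<open>banach\<close> provides the complete norm and the scalar multiplication by reals; \<open>s\<close> is the
  multiplication by scalars in \<open>'k\<close>, which must extend the real one. The definitions below take
  \<open>s\<close> as a parameter, so that they cover real spaces (\<open>s = scaleR\<close>) and complex spaces alike.
\<close>

locale banach_space_over = vector_space s
  for s :: "'k::real_normed_field \<Rightarrow> 'a::banach \<Rightarrow> 'a" +
  assumes scale_of_real: "s (of_real r) x = r *\<^sub>R x"
    and norm_scale: "norm (s c x) = norm c * norm x"

lemma banach_space_over_scaleR: "banach_space_over (scaleR :: real \<Rightarrow> 'a::banach \<Rightarrow> 'a)"
  by unfold_locales (auto simp: algebra_simps)

text \<open>\<open>'a \<Rightarrow>\<^sub>L 'b\<close> consists of the real-linear bounded maps; we single out the \<open>'k\<close>-linear ones.\<close>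

definition operators :: "('k::real_normed_field \<Rightarrow> 'a::banach \<Rightarrow> 'a) \<Rightarrow> ('a \<Rightarrow>\<^sub>L 'a) set" where
  "operators s = {T. \<forall>c x. blinfun_apply T (s c x) = s c (blinfun_apply T x)}"

definition dual :: "('k::real_normed_field \<Rightarrow> 'a::banach \<Rightarrow> 'a) \<Rightarrow> ('a \<Rightarrow>\<^sub>L 'k) set" where
  "dual s = {f. \<forall>c x. blinfun_apply f (s c x) = c * blinfun_apply f x}"

definition weak_operator_topology ::
  "('k::real_normed_field \<Rightarrow> 'a::banach \<Rightarrow> 'a) \<Rightarrow> ('a \<Rightarrow>\<^sub>L 'a) topology" where
  "weak_operator_topology s = topology_generated_by
     {{T \<in> operators s. blinfun_apply f (blinfun_apply T x) \<in> U} | f x U. f \<in> dual s \<and> open U}"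

lemma topspace_weak_operator_topology:
  fixes s :: "'k::real_normed_field \<Rightarrow> 'a::banach \<Rightarrow> 'a"
  shows "topspace (weak_operator_topology s) = operators s"
proof -
  have "operators s = {T \<in> operators s. blinfun_apply (0 :: 'a \<Rightarrow>\<^sub>L 'k) (blinfun_apply T 0) \<in> UNIV}"
    by simp
  moreover have "(0 :: 'a \<Rightarrow>\<^sub>L 'k) \<in> dual s"
    by (simp add: dual_def)
  ultimately have "operators s \<in>
      {{T \<in> operators s. blinfun_apply f (blinfun_apply T x) \<in> U} | f x U. f \<in> dual s \<and> open U}"
    by blast
  then show ?thesis
    unfolding weak_operator_topology_def topology_generated_by_topspace by blast
qed

definition G_set :: "('k::real_normed_field \<Rightarrow> 'a::banach \<Rightarrow> 'a) \<Rightarrow> 'a set \<Rightarrow> ('a \<Rightarrow>\<^sub>L 'a) set" where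
  "G_set s K = {D \<in> operators s. K \<subseteq> blinfun_apply D ` K}"

definition WG_set :: "('k::real_normed_field \<Rightarrow> 'a::banach \<Rightarrow> 'a) \<Rightarrow> 'a set \<Rightarrow> ('a \<Rightarrow>\<^sub>L 'a) set" where
  "WG_set s K = weak_operator_topology s closure_of G_set s K"

definition V_space :: "('k::real_normed_field \<Rightarrow> 'a::banach \<Rightarrow> 'a) \<Rightarrow> 'a set \<Rightarrow> 'a set" where
  "V_space s K = closure (module.span s K)"

definition A_alg :: "('k::real_normed_field \<Rightarrow> 'a::banach \<Rightarrow> 'a) \<Rightarrow> 'a set \<Rightarrow> ('a \<Rightarrow>\<^sub>L 'a) set" where
  "A_alg s K = {T \<in> operators s. blinfun_apply T ` V_space s K \<subseteq> V_space s K}"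

definition absolutely_convex :: "('k::real_normed_field \<Rightarrow> 'a::banach \<Rightarrow> 'a) \<Rightarrow> 'a set \<Rightarrow> bool" where
  "absolutely_convex s K \<longleftrightarrow> convex K \<and> (\<forall>c. norm c \<le> 1 \<longrightarrow> s c ` K \<subseteq> K)"

definition infinite_dimensional :: "('k::real_normed_field \<Rightarrow> 'a::banach \<Rightarrow> 'a) \<Rightarrow> 'a set \<Rightarrow> bool" where
  "infinite_dimensional s K \<longleftrightarrow> \<not> (\<exists>B. finite B \<and> module.span s K = module.span s B)"

end

theory Submission imports Defs begin

text \<open>
  For finite sets \<open>F\<close> of functionals and \<open>X\<close> of vectors we find \<open>D \<in> G(K)\<close> with
  \<open>f (D x) = f (T x)\<close> exactly, for all \<open>f \<in> F\<close>, \<open>x \<in> X\<close>. Take a finite-rank \<open>P\<close> with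
  \<open>f \<circ> P = f\<close> for \<open>f \<in> F\<close> which on \<open>lin K\<close> is the projection \<open>\<Sum> e\<^sub>w \<otimes> w\<close> onto a finite set of
  \<open>w \<in> lin K\<close>; as \<open>lin K\<close> is infinite-dimensional, the \<open>w\<close> can be chosen linearly independent modulo
  \<open>X\<close>, so by Hahn-Banach there are functionals \<open>a\<^sub>w\<close> biorthogonal to them that vanish on \<open>X\<close>. Put
  \<open>D = N (1 - P) + P T + \<Sum> h\<^sub>w \<otimes> w\<close>, where \<open>h\<^sub>w\<close> is the combination of the \<open>a\<^sub>v\<close> for which
  \<open>e\<^sub>w \<circ> T + h\<^sub>w\<close> equals \<open>N\<close> at \<open>w\<close> and \<open>0\<close> at the other \<open>v\<close>. The first summand is invisible to \<open>F\<close>,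
  the last one to \<open>X\<close>. Since \<open>T\<close> preserves the closure of \<open>lin K\<close>, the equation \<open>D x = k\<close> can be
  solved there explicitly, and its solution \<open>N\<inverse> (k - \<Sum> t\<^sub>w w)\<close> with bounded \<open>t\<^sub>w\<close> lies in \<open>K\<close> for
  large \<open>N\<close>.
\<close>

section \<open>Sublinear functionals and the Hahn-Banach theorem\<close>

definition sublinear :: "('a::real_vector \<Rightarrow> real) \<Rightarrow> bool" where
  "sublinear q \<longleftrightarrow> (\<forall>x y. q (x + y) \<le> q x + q y) \<and> (\<forall>t\<ge>0. \<forall>x. q (t *\<^sub>R x) = t * q x)"

lemma sublinear_add: "sublinear q \<Longrightarrow> q (x + y) \<le> q x + q y"
  and sublinear_scale: "sublinear q \<Longrightarrow> t \<ge> 0 \<Longrightarrow> q (t *\<^sub>R x) = t * q x"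
  by (auto simp: sublinear_def)

lemma sublinear_zero: "sublinear q \<Longrightarrow> q 0 = 0"
  using sublinear_scale[of q 0 0] by simp

lemma sublinear_minus: "sublinear q \<Longrightarrow> - q (- x) \<le> q x"
  using sublinear_add[of q x "- x"] sublinear_zero[of q] by simp

text \<open>Applying the scaling inequality to \<open>inverse t\<close> gives its converse, so one
  direction for positive \<open>t\<close> suffices.\<close>

lemma sublinearI:
  assumes add: "\<And>x y. q (x + y) \<le> q x + q y"
    and scale: "\<And>t x. t > 0 \<Longrightarrow> q (t *\<^sub>R x) \<le> t * q x" and zero: "q 0 = 0"
  shows "sublinear q"
  unfolding sublinear_def
proof (intro conjI allI impI add)
  fix t :: real and x assume "t \<ge> 0"
  show "q (t *\<^sub>R x) = t * q x"
  proof (cases "t = 0")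
    case False
    with \<open>t \<ge> 0\<close> have t: "t > 0" by simp
    have "q x \<le> inverse t * q (t *\<^sub>R x)"
      using scale[of "inverse t" "t *\<^sub>R x"] t by simp
    then have "t * q x \<le> q (t *\<^sub>R x)" using t by (simp add: field_simps)
    with scale[OF t, of x] show ?thesis by simp
  qed (simp add: zero)
qed

lemma sublinear_norm: "sublinear (norm :: 'a::real_normed_vector \<Rightarrow> real)"
  by (auto simp: sublinear_def norm_triangle_ineq)

text \<open>The classical device behind Hahn-Banach: \<open>q\<close> is lowered as far as
  subadditivity along the ray through \<open>w\<close> permits. The infimum is finite because every
  term is at least \<open>- q (- x)\<close>; the term \<open>t = 1\<close> gives the bound at
  \<open>- w\<close>.\<close>

lemma sublinear_cut:
  fixes q :: "'a::real_vector \<Rightarrow> real"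
  assumes q: "sublinear q"
  obtains r where "sublinear r" "\<And>x. r x \<le> q x" "r (- w) \<le> - q w"
proof -
  define r where "r x = (INF t\<in>{0..}. q (x + t *\<^sub>R w) - t * q w)" for x
  have low: "- q (- x) \<le> q (x + t *\<^sub>R w) - t * q w" if "t \<ge> 0" for x t
    using sublinear_add[OF q, of "x + t *\<^sub>R w" "- x"] sublinear_scale[OF q that, of w] by simp
  have bdd: "bdd_below ((\<lambda>t. q (x + t *\<^sub>R w) - t * q w) ` {0..})" for x
    using low by (intro bdd_belowI2[of _ "- q (- x)"]) auto
  have up: "r x \<le> q (x + t *\<^sub>R w) - t * q w" if "t \<ge> 0" for x t
    unfolding r_def by (intro cINF_lower bdd) (use that in simp)
  have glb: "c \<le> r x" if "\<And>t. t \<ge> 0 \<Longrightarrow> c \<le> q (x + t *\<^sub>R w) - t * q w" for c x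
    unfolding r_def by (rule cINF_greatest) (use that in auto)
  have le: "r x \<le> q x" for x using up[of 0 x] by simp
  have "sublinear r"
  proof (rule sublinearI)
    fix x y
    \<comment> \<open>For parameters \<open>t\<close> at \<open>x\<close> and \<open>u\<close> at
      \<open>y\<close>, the parameter \<open>t + u\<close> is admissible at \<open>x + y\<close>;
      the infima over \<open>t\<close> and \<open>u\<close> are then taken one after the
      other.\<close>
    have "r (x + y) - (q (y + u *\<^sub>R w) - u * q w) \<le> r x" if u: "u \<ge> 0" for u
    proof (rule glb)
      fix t :: real assume t: "t \<ge> 0"
      have "r (x + y) \<le> q ((x + y) + (t + u) *\<^sub>R w) - (t + u) * q w" using up t u by simp
      moreover have "q ((x + y) + (t + u) *\<^sub>R w) \<le> q (x + t *\<^sub>R w) + q (y + u *\<^sub>R w)"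
        using sublinear_add[OF q, of "x + t *\<^sub>R w" "y + u *\<^sub>R w"] by (simp add: algebra_simps)
      ultimately show "r (x + y) - (q (y + u *\<^sub>R w) - u * q w) \<le> q (x + t *\<^sub>R w) - t * q w"
        by (simp add: algebra_simps)
    qed
    then have "r (x + y) - r x \<le> r y" by (intro glb) (simp add: algebra_simps)
    then show "r (x + y) \<le> r x + r y" by simp
  next
    fix t :: real and x assume t: "t > 0"
    have "r (t *\<^sub>R x) / t \<le> r x"
    proof (rule glb)
      fix u :: real assume u: "u \<ge> 0"
      have "r (t *\<^sub>R x) \<le> q (t *\<^sub>R x + (t * u) *\<^sub>R w) - (t * u) * q w" using up t u by simp
      also have "q (t *\<^sub>R x + (t * u) *\<^sub>R w) = t * q (x + u *\<^sub>R w)"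
        using sublinear_scale[OF q, of t "x + u *\<^sub>R w"] t by (simp add: algebra_simps)
      finally show "r (t *\<^sub>R x) / t \<le> q (x + u *\<^sub>R w) - u * q w"
        using t by (simp add: field_simps)
    qed
    then show "r (t *\<^sub>R x) \<le> t * r x" using t by (simp add: field_simps)
  next
    have "0 \<le> r 0" by (rule glb) (use sublinear_scale[OF q] in simp)
    then show "r 0 = 0" using le[of 0] sublinear_zero[OF q] by simp
  qed
  moreover have "r (- w) \<le> - q w" using up[of 1 "- w"] sublinear_zero[OF q] by simp
  ultimately show thesis using that le by blast
qed


text \<open>A minimal sublinear functional \<open>m\<close> is linear: cutting at \<open>w\<close> cannot decrease it, so
  \<open>m (- w) \<le> - m w\<close>.\<close>

lemma exists_linear_below_sublinear:
  fixes p :: "'a::real_vector \<Rightarrow> real"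
  assumes p: "sublinear p"
  obtains g where "linear g" "\<And>x. g x \<le> p x"
proof -
  define A where "A = {q. sublinear q \<and> q \<le> p}"
  have "\<exists>m\<in>A. \<forall>a\<in>A. a \<le> m \<longrightarrow> a = m"
  proof (rule predicate_Zorn)
    \<comment> \<open>The order is reversed, so that Zorn's lemma yields a minimal element.\<close>
    show "partial_order_on A (relation_of (\<lambda>x y. y \<le> x) A)"
      by (rule partial_order_on_relation_ofI) auto
    fix C assume C: "C \<in> Chains (relation_of (\<lambda>x y. y \<le> x) A)"
    then have CA: "C \<subseteq> A" and tot: "\<And>a b. a \<in> C \<Longrightarrow> b \<in> C \<Longrightarrow> a \<le> b \<or> b \<le> a"
      by (auto simp: Chains_def relation_of_def)
    show "\<exists>u\<in>A. \<forall>a\<in>C. u \<le> a"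
    proof (cases "C = {}")
      case True
      with p show ?thesis by (auto simp: A_def)
    next
      case False
      \<comment> \<open>The pointwise infimum is finite, since \<open>q \<le> p\<close> forces
        \<open>q x \<ge> - p (- x)\<close>.\<close>
      define u where "u x = (INF q\<in>C. q x)" for x
      have sub: "sublinear q" and below: "q x \<le> p x" if "q \<in> C" for q x
        using that CA by (auto simp: A_def le_fun_def)
      have low: "- p (- x) \<le> q x" if "q \<in> C" for q x
        using sublinear_minus[OF sub[OF that], of x] below[OF that, of "- x"] by linarith
      have up: "u x \<le> q x" if "q \<in> C" for q x
        unfolding u_def by (intro cINF_lower bdd_belowI2[of _ "- p (- x)"]) (use that low in auto)
      have glb: "c \<le> u x" if "\<And>q. q \<in> C \<Longrightarrow> c \<le> q x" for c x
        unfolding u_def by (rule cINF_greatest) (use that False in auto)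
      have "sublinear u"
      proof (rule sublinearI)
        fix x y
        have "u (x + y) - q2 y \<le> u x" if q2: "q2 \<in> C" for q2
        proof (rule glb)
          fix q1 assume q1: "q1 \<in> C"
          \<comment> \<open>Comparability in the chain gives one member below both \<open>q1\<close>
            and \<open>q2\<close>, whose subadditivity bounds \<open>u (x + y)\<close>.\<close>
          obtain q where "q \<in> C" "q \<le> q1" "q \<le> q2" using tot[OF q1 q2] q1 q2 by blast
          moreover have "u (x + y) \<le> q x + q y"
            using up[OF \<open>q \<in> C\<close>, of "x + y"] sublinear_add[OF sub[OF \<open>q \<in> C\<close>], of x y] by linarith
          ultimately show "u (x + y) - q2 y \<le> q1 x"
            unfolding le_fun_def by (smt (verit))
        qed
        then have "u (x + y) - u x \<le> u y" by (intro glb) (simp add: algebra_simps)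
        then show "u (x + y) \<le> u x + u y" by simp
      next
        fix t :: real and x assume t: "t > 0"
        have "u (t *\<^sub>R x) / t \<le> u x"
          by (rule glb) (use up[of _ "t *\<^sub>R x"] sublinear_scale[OF sub, of _ t x] t in
            \<open>simp add: field_simps\<close>)
        then show "u (t *\<^sub>R x) \<le> t * u x" using t by (simp add: field_simps)
      next
        show "u 0 = 0"
          using False up[of _ 0] glb[of 0 0] sublinear_zero[OF sub] by force
      qed
      moreover have "u \<le> p" using False up below by (metis ex_in_conv le_funI order_trans)
      ultimately show ?thesis using up by (auto simp: A_def le_fun_def)
    qed
  qed
  then obtain m where m: "sublinear m" "m \<le> p"
    and min: "\<And>a. sublinear a \<Longrightarrow> a \<le> p \<Longrightarrow> a \<le> m \<Longrightarrow> a = m"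
    unfolding A_def by blast
  have odd: "m (- w) = - m w" for w
  proof -
    obtain r where r: "sublinear r" "\<And>x. r x \<le> m x" "r (- w) \<le> - m w"
      using sublinear_cut[OF m(1)] by blast
    then have "r = m" using m(2) by (intro min) (auto simp: le_fun_def intro: order_trans)
    with r(3) sublinear_minus[OF m(1), of w] show ?thesis by simp
  qed
  have "linear m"
  proof (rule linearI)
    fix x y
    have "m x \<le> m (x + y) + m (- y)" using sublinear_add[OF m(1), of "x + y" "- y"] by simp
    with sublinear_add[OF m(1), of x y] odd show "m (x + y) = m x + m y" by simp
  next
    fix t x
    show "m (t *\<^sub>R x) = t *\<^sub>R m x"
      using sublinear_scale[OF m(1), of t x] sublinear_scale[OF m(1), of "- t" x] odd[of "t *\<^sub>R x"]
      by (cases "t \<ge> 0") auto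
  qed
  with m(2) that show thesis by (auto simp: le_fun_def)
qed

section \<open>Bounded functionals separating points, over the reals and the complex numbers\<close>

lemma exists_functional_nonzero:
  fixes w :: "'a::real_normed_vector"
  assumes "w \<noteq> 0"
  obtains g :: "'a \<Rightarrow>\<^sub>L real" where "g w \<noteq> 0"
proof -
  \<comment> \<open>After cutting the norm at \<open>w\<close>, every linear \<open>g\<close> below
    \<open>r\<close> has \<open>g (- w) \<le> - norm w\<close>, that is,
    \<open>g w \<ge> norm w > 0\<close>.\<close>
  obtain r where r: "sublinear r" "\<And>x. r x \<le> norm x" "r (- w) \<le> - norm w"
    using sublinear_cut[OF sublinear_norm] by blast
  obtain g where g: "linear g" "\<And>x. g x \<le> r x" using exists_linear_below_sublinear[OF r(1)] by blast
  have "\<bar>g x\<bar> \<le> norm x" for x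
    using g(2)[of x] r(2)[of x] g(2)[of "- x"] r(2)[of "- x"] linear_neg[OF g(1), of x] by simp
  then have "bounded_linear g"
    using g(1) by (intro bounded_linear_intro[of _ 1]) (auto simp: linear_iff)
  moreover have "g w \<noteq> 0" using g(2)[of "- w"] r(3) linear_neg[OF g(1), of w] assms
    by (smt (verit) zero_less_norm_iff)
  ultimately show thesis using that by (metis bounded_linear_Blinfun_apply)
qed

text \<open>Hahn-Banach enters the later construction only through this separation property, so the
  argument can be run once for both scalar fields.\<close>

locale separating_dual = banach_space_over s
  for s :: "'k::real_normed_field \<Rightarrow> 'a::banach \<Rightarrow> 'a" +
  assumes separating: "w \<noteq> 0 \<Longrightarrow> \<exists>f\<in>dual s. blinfun_apply f w \<noteq> 0"

lemma separating_dual_real: "separating_dual (scaleR :: real \<Rightarrow> 'a::banach \<Rightarrow> 'a)"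
proof -
  interpret banach_space_over "scaleR :: real \<Rightarrow> 'a \<Rightarrow> 'a" by (rule banach_space_over_scaleR)
  show ?thesis
  proof
    fix w :: 'a assume "w \<noteq> 0"
    then obtain g :: "'a \<Rightarrow>\<^sub>L real" where "g w \<noteq> 0" by (rule exists_functional_nonzero)
    then show "\<exists>f\<in>dual (scaleR :: real \<Rightarrow> 'a \<Rightarrow> 'a). blinfun_apply f w \<noteq> 0"
      by (auto simp: dual_def blinfun.scaleR_right)
  qed
qed

text \<open>A real functional \<open>g\<close> is the real part of the complex-linear functional
  \<open>g x - \<i> * g (s \<i> x)\<close>, which is therefore nonzero wherever \<open>g\<close>
  is.\<close>

lemma separating_dual_complex:
  fixes s :: "complex \<Rightarrow> 'a::banach \<Rightarrow> 'a"
  assumes "banach_space_over s"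
  shows "separating_dual s"
proof -
  interpret banach_space_over s by fact
  show ?thesis
  proof
    fix w :: 'a assume "w \<noteq> 0"
    then obtain g :: "'a \<Rightarrow>\<^sub>L real" where g: "g w \<noteq> 0" by (rule exists_functional_nonzero)
    have si: "s \<i> (s \<i> x) = - x" for x using scale_of_real[of "-1" x] by simp
    have real: "s \<i> (r *\<^sub>R x) = r *\<^sub>R s \<i> x" for r x
      by (simp flip: scale_of_real add: mult.commute)
    have "bounded_linear (s \<i>)"
      by (rule bounded_linear_intro[of _ 1]) (simp_all add: scale_right_distrib real norm_scale)
    then have "bounded_linear (\<lambda>x. of_real (g x) - \<i> * of_real (g (s \<i> x)) :: complex)"
      by (intro bounded_linear_sub bounded_linear_const_mult
        bounded_linear_compose[OF bounded_linear_of_real]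
        bounded_linear_compose[OF blinfun.bounded_linear_right] blinfun.bounded_linear_right)
    moreover define f where "f = Blinfun (\<lambda>x. of_real (g x) - \<i> * of_real (g (s \<i> x)) :: complex)"
    ultimately have f: "f x = of_real (g x) - \<i> * of_real (g (s \<i> x))" for x
      by (simp add: bounded_linear_Blinfun_apply)
    have "f (s c x) = c * f x" for c x
    proof -
      have "s c x = s (of_real (Re c) + of_real (Im c) * \<i>) x"
        by (simp add: complex_eq mult.commute)
      also have "\<dots> = Re c *\<^sub>R x + Im c *\<^sub>R s \<i> x"
        by (simp only: scale_left_distrib scale_scale[symmetric] scale_of_real)
      finally have *: "s c x = Re c *\<^sub>R x + Im c *\<^sub>R s \<i> x" .
      show ?thesis
        unfolding * f
        by (simp add: scale_right_distrib real si blinfun.add_right blinfun.scaleR_right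
          blinfun.minus_right blinfun.diff_right complex_eq_iff algebra_simps)
    qed
    then have "f \<in> dual s" by (simp add: dual_def)
    moreover have "f w \<noteq> 0" using g f[of w] by (simp add: complex_eq_iff)
    ultimately show "\<exists>f\<in>dual s. blinfun_apply f w \<noteq> 0" by blast
  qed
qed

section \<open>Absolutely convex sets and the weak operator topology\<close>

lemma convex_cone_add:
  fixes p q :: "'a::real_vector"
  assumes "convex K" "p \<in> K" "q \<in> K" "\<alpha> \<ge> 0" "\<beta> \<ge> 0"
  shows "\<alpha> *\<^sub>R p + \<beta> *\<^sub>R q \<in> (*\<^sub>R) (\<alpha> + \<beta>) ` K"
proof (cases "\<alpha> + \<beta> = 0")
  case True
  then show ?thesis using assms by (auto simp: add_nonneg_eq_0_iff)
next
  case False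
  let ?r = "(\<alpha> / (\<alpha> + \<beta>)) *\<^sub>R p + (\<beta> / (\<alpha> + \<beta>)) *\<^sub>R q"
  have "?r \<in> K"
    using assms False by (intro convexD) (auto simp: add_divide_distrib[symmetric])
  moreover have "\<alpha> *\<^sub>R p + \<beta> *\<^sub>R q = (\<alpha> + \<beta>) *\<^sub>R ?r"
    using False by (simp add: scaleR_add_right)
  ultimately show ?thesis by blast
qed

context banach_space_over
begin

lemma scale_of_real_mult: "s (of_real r * c) x = r *\<^sub>R s c x"
  by (simp flip: scale_scale add: scale_of_real)

lemma bounded_linear_scale_left: "bounded_linear (\<lambda>c. s c x)"
  by (rule bounded_linear_intro[of _ "norm x"])
    (simp_all add: scale_left_distrib scaleR_conv_of_real scale_of_real_mult norm_scale)

lemma scale_scaleR: "s c (r *\<^sub>R x) = r *\<^sub>R s c x"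
  by (simp flip: scale_of_real add: mult.commute)

lemma dual_zero: "0 \<in> dual s"
  and dual_add: "f \<in> dual s \<Longrightarrow> g \<in> dual s \<Longrightarrow> f + g \<in> dual s"
  and dual_diff: "f \<in> dual s \<Longrightarrow> g \<in> dual s \<Longrightarrow> f - g \<in> dual s"
  and dual_scaleR: "f \<in> dual s \<Longrightarrow> r *\<^sub>R f \<in> dual s"
  and dual_mult: "f \<in> dual s \<Longrightarrow> blinfun_mult_right c o\<^sub>L f \<in> dual s"
  and dual_compose: "f \<in> dual s \<Longrightarrow> T \<in> operators s \<Longrightarrow> f o\<^sub>L T \<in> dual s"
  by (auto simp: dual_def operators_def blinfun.bilinear_simps algebra_simps)

lemma dual_sum: "(\<And>i. i \<in> I \<Longrightarrow> f i \<in> dual s) \<Longrightarrow> sum f I \<in> dual s"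
  by (induction I rule: infinite_finite_induct) (auto simp: dual_zero dual_add)

lemma operators_zero: "0 \<in> operators s"
  and operators_id: "id_blinfun \<in> operators s"
  and operators_add: "S \<in> operators s \<Longrightarrow> T \<in> operators s \<Longrightarrow> S + T \<in> operators s"
  and operators_diff: "S \<in> operators s \<Longrightarrow> T \<in> operators s \<Longrightarrow> S - T \<in> operators s"
  and operators_scaleR: "T \<in> operators s \<Longrightarrow> r *\<^sub>R T \<in> operators s"
  and operators_compose: "S \<in> operators s \<Longrightarrow> T \<in> operators s \<Longrightarrow> S o\<^sub>L T \<in> operators s"
  by (auto simp: operators_def blinfun.bilinear_simps scale_right_distrib scale_right_diff_distrib
      scale_scaleR)

lemma operators_sum: "(\<And>i. i \<in> I \<Longrightarrow> T i \<in> operators s) \<Longrightarrow> sum T I \<in> operators s"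
  by (induction I rule: infinite_finite_induct) (auto simp: operators_zero operators_add)

definition rank_one :: "('a \<Rightarrow>\<^sub>L 'k) \<Rightarrow> 'a \<Rightarrow> ('a \<Rightarrow>\<^sub>L 'a)" where
  "rank_one f u = Blinfun (\<lambda>x. s (f x) u)"

lemma rank_one_apply [simp]: "rank_one f u x = s (f x) u"
  unfolding rank_one_def
  by (subst bounded_linear_Blinfun_apply)
    (auto intro!: bounded_linear_compose[OF bounded_linear_scale_left] blinfun.bounded_linear_right)

lemma rank_one_operators: "f \<in> dual s \<Longrightarrow> rank_one f u \<in> operators s"
  by (simp add: dual_def operators_def)

lemma dual_scale: "f \<in> dual s \<Longrightarrow> f (s c x) = c * f x"
  by (simp add: dual_def)

section \<open>Linear combinations of points of an absolutely convex set\<close>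

lemma absolutely_convex_scale:
  assumes "absolutely_convex s K" "z \<in> K"
  shows "s c z \<in> (*\<^sub>R) (norm c) ` K"
proof (cases "c = 0")
  case True
  with assms show ?thesis by auto
next
  case False
  then have "norm (of_real (inverse (norm c)) * c) \<le> 1" by (simp add: norm_mult norm_inverse)
  with assms have "s (of_real (inverse (norm c)) * c) z \<in> K"
    unfolding absolutely_convex_def by blast
  moreover have "s c z = norm c *\<^sub>R s (of_real (inverse (norm c)) * c) z"
    using False by (simp add: scale_of_real_mult del: of_real_inverse)
  ultimately show ?thesis by blast
qed

text \<open>A combination is controlled by its total weight. This later places the solution of
  \<open>D x = k\<close> in \<open>K\<close>, once the weight is at most 1.\<close>

lemma absolutely_convex_sum:
  assumes K: "absolutely_convex s K" and "finite W" "k \<in> K" "\<And>w. w \<in> W \<Longrightarrow> z w \<in> K" "r \<ge> 0"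
  shows "r *\<^sub>R k + (\<Sum>w\<in>W. s (c w) (z w)) \<in> (*\<^sub>R) (r + (\<Sum>w\<in>W. norm (c w))) ` K"
  using assms(2-)
proof (induction W)
  case (insert w W)
  have conv: "convex K" using K by (simp add: absolutely_convex_def)
  obtain p where p: "p \<in> K"
    "r *\<^sub>R k + (\<Sum>w\<in>W. s (c w) (z w)) = (r + (\<Sum>w\<in>W. norm (c w))) *\<^sub>R p"
    using insert by auto
  obtain q where q: "q \<in> K" "s (c w) (z w) = norm (c w) *\<^sub>R q"
    using absolutely_convex_scale[OF K, of "z w" "c w"] insert by auto
  have "r *\<^sub>R k + (\<Sum>w\<in>insert w W. s (c w) (z w))
      = (r + (\<Sum>w\<in>W. norm (c w))) *\<^sub>R p + norm (c w) *\<^sub>R q"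
    using insert p q by (simp add: algebra_simps)
  also have "\<dots> \<in> (*\<^sub>R) (r + (\<Sum>w\<in>W. norm (c w)) + norm (c w)) ` K"
    by (intro convex_cone_add conv p q add_nonneg_nonneg sum_nonneg) (use insert in auto)
  finally show ?case using insert by (simp add: add_ac)
qed auto

lemma absolutely_convex_shrink:
  assumes "absolutely_convex s K" "z \<in> K" "0 \<le> r" "r \<le> 1"
  shows "r *\<^sub>R z \<in> K"
  using assms by (force simp: absolutely_convex_def simp flip: scale_of_real)

text \<open>Sums of multiples of points of \<open>K\<close> merge into one multiple of one point, so
  the span is a union of dilates of \<open>K\<close>.\<close>

lemma absolutely_convex_span:
  assumes K: "absolutely_convex s K" and ne: "K \<noteq> {}" and x: "x \<in> span K"
  obtains r z where "z \<in> K" "r \<ge> 0" "x = r *\<^sub>R z"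
proof -
  have "\<exists>r z. z \<in> K \<and> r \<ge> 0 \<and> x = r *\<^sub>R z"
    using x
  proof (induction rule: span_induct_alt)
    case base
    obtain z where "z \<in> K" using ne by blast
    then show ?case by (intro exI[of _ 0] exI[of _ z]) simp
  next
    case (step c x y)
    then obtain r z where y: "z \<in> K" "r \<ge> 0" "y = r *\<^sub>R z" by blast
    obtain q where q: "q \<in> K" "s c x = norm c *\<^sub>R q"
      using absolutely_convex_scale[OF K step(1), of c] by auto
    have "norm c *\<^sub>R q + r *\<^sub>R z \<in> (*\<^sub>R) (norm c + r) ` K"
      using K y q by (intro convex_cone_add) (auto simp: absolutely_convex_def)
    then obtain q' where "q' \<in> K" "s c x + y = (norm c + r) *\<^sub>R q'" using y q by auto
    then show ?case using y by (meson add_nonneg_nonneg norm_ge_zero)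
  qed
  with that show thesis by blast
qed

text \<open>A maximal independent subset of \<open>K\<close> generates \<open>span K\<close>; inside
  \<open>span B\<close> it would be finite. In this form infinite dimension supplies vectors outside
  any given finite-dimensional subspace.\<close>

lemma infinite_dimensional_not_subset_span:
  assumes inf: "infinite_dimensional s K" and B: "finite B"
  shows "\<not> span K \<subseteq> span B"
proof
  assume sub: "span K \<subseteq> span B"
  obtain C where C: "C \<subseteq> K" "independent C" "K \<subseteq> span C"
    using maximal_independent_subset by blast
  have "C \<subseteq> span B" using C(1) sub span_superset by blast
  then have "finite C" using independent_span_bound[OF B C(2)] by simp
  moreover have "span K = span C"
    using C by (intro subset_antisym span_mono span_minimal subspace_span)
  ultimately show False using inf by (auto simp: infinite_dimensional_def)
qed

text \<open>A neighbourhood of \<open>T\<close> constrains only finitely many values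
  \<open>f (T x)\<close>, so exact agreement on arbitrary finite data is enough for
  approximation.\<close>

lemma in_WOT_closure_of:
  fixes T :: "'a \<Rightarrow>\<^sub>L 'a"
  assumes T: "T \<in> operators s"
    and approx: "\<And>F X. finite F \<Longrightarrow> F \<subseteq> dual s \<Longrightarrow> finite X \<Longrightarrow>
      \<exists>D\<in>A \<inter> operators s. \<forall>f\<in>F. \<forall>x\<in>X. blinfun_apply f (blinfun_apply D x) = blinfun_apply f (T x)"
  shows "T \<in> weak_operator_topology s closure_of A"
proof -
  let ?S = "{{T \<in> operators s. blinfun_apply f (blinfun_apply T x) \<in> U} | f x U. f \<in> dual s \<and> open U}"
  have nbhd: "\<exists>F X. finite F \<and> F \<subseteq> dual s \<and> finite X \<and>
      (\<forall>D\<in>operators s. (\<forall>f\<in>F. \<forall>x\<in>X. blinfun_apply f (blinfun_apply D x) = blinfun_apply f (T x)) \<longrightarrow> D \<in> U)"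
    if "generate_topology_on ?S U" "T \<in> U" for U
    using that
  proof (induction rule: generate_topology_on.induct)
    case (Int U V)
    then obtain F X G Y where "finite F" "F \<subseteq> dual s" "finite X" "finite G" "G \<subseteq> dual s" "finite Y"
      "\<forall>D\<in>operators s. (\<forall>f\<in>F. \<forall>x\<in>X. blinfun_apply f (blinfun_apply D x) = blinfun_apply f (T x)) \<longrightarrow> D \<in> U"
      "\<forall>D\<in>operators s. (\<forall>f\<in>G. \<forall>x\<in>Y. blinfun_apply f (blinfun_apply D x) = blinfun_apply f (T x)) \<longrightarrow> D \<in> V"
      by (auto 0 0)
    \<comment> \<open>Enlarging both finite sets only strengthens the agreement demanded, so two
      pairs can be merged by unions.\<close>
    then show ?case
      by (intro exI[of _ "F \<union> G"] exI[of _ "X \<union> Y"]) auto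
  next
    case (UN \<U>)
    then obtain U where "U \<in> \<U>" "T \<in> U" by blast
    with UN.IH[OF this] show ?case by (meson UnionI)
  next
    case (Basis U)
    then obtain f x V where "f \<in> dual s" "U = {T \<in> operators s. blinfun_apply f (blinfun_apply T x) \<in> V}" by blast
    with \<open>T \<in> U\<close> show ?case by (intro exI[of _ "{f}"] exI[of _ "{x}"]) auto
  qed auto
  show ?thesis
    unfolding in_closure_of topspace_weak_operator_topology
  proof (intro conjI T allI impI)
    fix U assume U: "T \<in> U \<and> openin (weak_operator_topology s) U"
    then have "generate_topology_on ?S U"
      by (simp add: weak_operator_topology_def openin_topology_generated_by_iff)
    with U nbhd[of U] obtain F X where FX: "finite F" "F \<subseteq> dual s" "finite X"
      "\<forall>D\<in>operators s. (\<forall>f\<in>F. \<forall>x\<in>X. blinfun_apply f (blinfun_apply D x) = blinfun_apply f (T x)) \<longrightarrow> D \<in> U"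
      by blast
    with approx[OF FX(1-3)] show "\<exists>D. D \<in> A \<and> D \<in> U" by blast
  qed
qed

end

section \<open>Interpolation by operators in \<open>G(K)\<close>\<close>

context separating_dual
begin

text \<open>Induction on \<open>B\<close>: a functional for the smaller set is corrected by a
  multiple of another one, so that it vanishes at the new vector too.\<close>

lemma exists_functional_vanishing:
  assumes "finite B" "w \<notin> span B"
  obtains f where "f \<in> dual s" "\<And>b. b \<in> B \<Longrightarrow> blinfun_apply f b = 0" "f w = 1"
proof -
  have "\<exists>f\<in>dual s. (\<forall>b\<in>B. blinfun_apply f b = 0) \<and> f w = 1"
    using assms
  proof (induction B arbitrary: w)
    case empty
    then obtain f where "f \<in> dual s" "blinfun_apply f w \<noteq> 0" using separating by auto
    then show ?case
      by (intro bexI[of _ "blinfun_mult_right (inverse (f w)) o\<^sub>L f"] dual_mult) auto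
  next
    case (insert b B)
    show ?case
    proof (cases "b \<in> span B")
      case True
      then have "w \<notin> span B" using insert.prems by (simp add: span_redundant)
      then obtain f where f: "f \<in> dual s" "\<forall>b\<in>B. blinfun_apply f b = 0" "f w = 1"
        using insert.IH by blast
      have "f b = 0" using True
        by (induction rule: span_induct_alt) (use f dual_scale in \<open>auto simp: blinfun.bilinear_simps\<close>)
      with f show ?thesis by auto
    next
      case False
      then obtain f where f: "f \<in> dual s" "\<forall>b\<in>B. blinfun_apply f b = 0" "f b = 1"
        using insert.IH by blast
      \<comment> \<open>Subtracting \<open>s (f w) b\<close> makes the correction harmless:
        \<open>g - g b * f\<close> takes at \<open>w\<close> the value
        \<open>g (w - s (f w) b) = 1\<close>.\<close>
      have "w - s (f w) b \<notin> span B"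
        using insert.prems span_breakdown_eq by blast
      then obtain g where g: "g \<in> dual s" "\<forall>b\<in>B. blinfun_apply g b = 0" "g (w - s (f w) b) = 1"
        using insert.IH by blast
      show ?thesis
        by (rule bexI[of _ "g - (blinfun_mult_right (g b) o\<^sub>L f)"])
          (use f g in \<open>auto intro!: dual_diff dual_mult simp: blinfun.bilinear_simps dual_scale mult.commute\<close>)
    qed
  qed
  with that show thesis by blast
qed

section \<open>Projections adapted to finitely many functionals and vectors\<close>

text \<open>The \<open>e w\<close> are the coordinates of \<open>P\<close> on \<open>S\<close>,
  while the \<open>a w\<close> serve for corrections invisible on \<open>X\<close>. The formula for
  \<open>P\<close> is imposed on \<open>S\<close> only: some functionals in \<open>F\<close> may
  vanish on \<open>S\<close>, and \<open>P\<close> must then have range beyond the span of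
  \<open>W\<close>.\<close>

definition adapted_system ::
  "('a \<Rightarrow>\<^sub>L 'k) set \<Rightarrow> 'a set \<Rightarrow> 'a set \<Rightarrow> 'a set \<Rightarrow> ('a \<Rightarrow> ('a \<Rightarrow>\<^sub>L 'k)) \<Rightarrow> ('a \<Rightarrow> ('a \<Rightarrow>\<^sub>L 'k)) \<Rightarrow>
    ('a \<Rightarrow>\<^sub>L 'a) \<Rightarrow> bool" where
  "adapted_system F X S W e a P \<longleftrightarrow>
     finite W \<and> W \<subseteq> S \<and> P \<in> operators s \<and>
     (\<forall>w\<in>W. e w \<in> dual s \<and> a w \<in> dual s) \<and>
     (\<forall>w\<in>W. \<forall>v\<in>W. e w v = (if v = w then 1 else 0) \<and> a w v = (if v = w then 1 else 0)) \<and>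
     (\<forall>w\<in>W. \<forall>x\<in>X. a w x = 0) \<and>
     (\<forall>f\<in>F. \<forall>x. f (P x) = f x) \<and>
     (\<forall>x\<in>S. P x = (\<Sum>w\<in>W. s (e w x) w))"

text \<open>Functionals are added one at a time, each by a rank-one update of \<open>P\<close>.
  Infinite dimension keeps the vectors of \<open>W\<close> independent modulo
  \<open>X\<close>.\<close>

lemma adapted_system_exists:
  assumes "finite F" "F \<subseteq> dual s" and X: "finite X" and S: "subspace S"
    and inf: "\<And>B. finite B \<Longrightarrow> \<not> S \<subseteq> span B"
  shows "\<exists>W e a P. adapted_system F X S W e a P"
  using assms(1,2)
proof (induction F)
  case empty
  have "adapted_system {} X S {} (\<lambda>_. 0) (\<lambda>_. 0) 0"
    by (simp add: adapted_system_def operators_zero)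
  then show ?case by blast
next
  case (insert g F)
  then obtain W e a P where sys: "adapted_system F X S W e a P" by auto
  then have W: "finite W" "W \<subseteq> S" and P: "P \<in> operators s"
    and dual: "\<And>w. w \<in> W \<Longrightarrow> e w \<in> dual s" "\<And>w. w \<in> W \<Longrightarrow> a w \<in> dual s"
    and e: "\<And>w v. w \<in> W \<Longrightarrow> v \<in> W \<Longrightarrow> e w v = (if v = w then 1 else 0)"
    and a: "\<And>w v. w \<in> W \<Longrightarrow> v \<in> W \<Longrightarrow> a w v = (if v = w then 1 else 0)"
    and aX: "\<And>w x. w \<in> W \<Longrightarrow> x \<in> X \<Longrightarrow> a w x = 0"
    and FP: "\<And>f x. f \<in> F \<Longrightarrow> f (P x) = f x"
    and PS: "\<And>x. x \<in> S \<Longrightarrow> P x = (\<Sum>w\<in>W. s (e w x) w)"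
    unfolding adapted_system_def by auto
  have F: "F \<subseteq> dual s" and g: "g \<in> dual s" using insert.prems by auto
  \<comment> \<open>The defect of \<open>P\<close> at the new functional \<open>g\<close>.\<close>
  define g' where "g' = g - (g o\<^sub>L P)"
  have g': "g' \<in> dual s" unfolding g'_def by (intro dual_diff dual_compose g P)
  have g'_apply: "g' x = g x - g (P x)" for x by (simp add: g'_def blinfun.bilinear_simps)
  \<comment> \<open>With \<open>g' v = 1\<close>, the vector \<open>v - P v\<close> is annihilated
    by the other functionals in \<open>F\<close> and sent to 1 by \<open>g\<close>, so adding
    \<open>rank_one g' u\<close> repairs \<open>g\<close> and preserves the rest.\<close>
  have update: "f ((P + rank_one g' u) x) = f x"
    if "f \<in> insert g F" and u: "u = v - P v" and v: "g' v = 1" for f u v x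
  proof -
    have "f u = (if f = g then 1 else 0)"
      using that FP[of f] by (auto simp: blinfun.bilinear_simps g'_apply)
    moreover have "f \<in> dual s" using that F g by auto
    ultimately show ?thesis
      using that(1) FP[of f x]
      by (auto simp: blinfun.bilinear_simps dual_scale g'_apply)
  qed
  \<comment> \<open>Either \<open>P\<close> already fits, or the update leaves \<open>P\<close>
    unchanged on \<open>S\<close> and \<open>W\<close> can stay, or \<open>v\<close> can be taken in
    \<open>S\<close> and \<open>v - P v\<close> becomes a new vector of \<open>W\<close> with
    coordinate \<open>g'\<close>.\<close>
  consider (zero) "g' = 0" | (off) "g' \<noteq> 0" "\<And>x. x \<in> S \<Longrightarrow> g' x = 0" | (on) "\<exists>p\<in>S. g' p \<noteq> 0"
    by blast
  then show ?case
  proof cases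
    case zero
    then have "g (P x) = g x" for x using g'_apply[of x] by simp
    then have "adapted_system (insert g F) X S W e a P"
      using sys by (auto simp: adapted_system_def)
    then show ?thesis by blast
  next
    case off
    then obtain v0 where "g' v0 \<noteq> 0" by (metis blinfun_eqI zero_blinfun.rep_eq)
    then have "g' (s (inverse (g' v0)) v0) = 1" by (simp add: dual_scale[OF g'])
    then obtain v where v: "g' v = 1" by blast
    have "adapted_system (insert g F) X S W e a (P + rank_one g' (v - P v))"
      unfolding adapted_system_def
      using W P dual e a aX update[OF _ refl v] off(2) PS
      by (auto intro!: operators_add rank_one_operators g' simp: blinfun.add_left)
    then show ?thesis by blast
  next
    case on
    then obtain p where p: "p \<in> S" "g' p \<noteq> 0" by blast
    obtain q where q: "q \<in> S" "q \<notin> span (X \<union> W)" using inf[of "X \<union> W"] X W by auto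
    txt \<open>\<open>S\<close> is not the union of two proper subspaces.\<close>
    obtain v0 where v0: "v0 \<in> S" "g' v0 \<noteq> 0" "v0 \<notin> span (X \<union> W)"
    proof (cases "p \<in> span (X \<union> W)")
      case False
      with p that show thesis by blast
    next
      case True
      show thesis
      proof (cases "g' q = 0")
        case True
        have "p + q \<notin> span (X \<union> W)"
          using \<open>p \<in> span (X \<union> W)\<close> q(2) span_add_eq[of p "X \<union> W" q] by simp
        then show thesis
          using that[of "p + q"] True p q S by (simp add: subspace_add blinfun.add_right)
      qed (use that q in blast)
    qed
    define v where "v = s (inverse (g' v0)) v0"
    have v: "v \<in> S" "g' v = 1" "v \<notin> span (X \<union> W)"
    proof -
      show "v \<in> S" "g' v = 1" using v0 S by (auto simp: v_def subspace_scale dual_scale[OF g'])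
      show "v \<notin> span (X \<union> W)"
      proof
        assume "v \<in> span (X \<union> W)"
        then have "s (g' v0) v \<in> span (X \<union> W)" by (rule span_scale)
        with v0 show False by (simp add: v_def)
      qed
    qed
    define u where "u = v - P v"
    have Pv: "P v \<in> span W" unfolding PS[OF v(1)] by (intro span_sum span_scale span_base)
    have "P v \<in> S" using PS[OF v(1)] W S by (auto intro!: subspace_sum subspace_scale)
    then have uS: "u \<in> S" using v S by (simp add: u_def subspace_diff)
    have u_span: "u \<notin> span (X \<union> W)"
    proof
      assume "u \<in> span (X \<union> W)"
      moreover have "P v \<in> span (X \<union> W)" using Pv span_mono[of W "X \<union> W"] by auto
      ultimately have "u + P v \<in> span (X \<union> W)" by (rule span_add)
      with v show False by (simp add: u_def)
    qed
    then have uW: "u \<notin> W" using span_base by blast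
    have eP: "e w (P x) = e w x" if "w \<in> W" "x \<in> S" for w x
    proof -
      have "e w (P x) = (\<Sum>v\<in>W. e v x * e w v)"
        by (simp add: PS that blinfun.sum_right dual_scale dual)
      also have "\<dots> = (\<Sum>v\<in>W. if v = w then e w x else 0)"
        using that by (intro sum.cong) (auto simp: e)
      finally show ?thesis using that W by simp
    qed
    have Pw: "P w = w" if "w \<in> W" for w
    proof -
      have "P w = (\<Sum>v\<in>W. if v = w then w else 0)"
        unfolding PS[OF subsetD[OF W(2) that]] by (intro sum.cong) (auto simp: e that)
      then show ?thesis using that W by simp
    qed
    \<comment> \<open>On \<open>S\<close> the map \<open>P\<close> is idempotent; hence
      \<open>g'\<close> vanishes at \<open>P v\<close> and keeps the value 1 at
      \<open>u\<close>.\<close>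
    have PP: "P (P v) = P v"
      using PS[OF \<open>P v \<in> S\<close>] PS[OF v(1)] eP[OF _ v(1)] by simp
    have eu: "e w u = 0" if "w \<in> W" for w
      using that eP v by (simp add: u_def blinfun.diff_right)
    have g'w: "g' w = 0" if "w \<in> W" for w using that by (simp add: g'_apply Pw)
    have g'u: "g' u = 1" using v by (simp add: u_def blinfun.diff_right g'_apply PP)
    \<comment> \<open>The functional \<open>b\<close> is the new member of the family
      \<open>a\<close>; subtracting multiples of it makes the old members vanish at \<open>u\<close>
      without changing them on \<open>X\<close> and \<open>W\<close>.\<close>
    obtain b where b: "b \<in> dual s" "\<And>x. x \<in> X \<union> W \<Longrightarrow> blinfun_apply b x = 0" "b u = 1"
      using exists_functional_vanishing[OF _ u_span] X W by blast
    define e' where "e' = e(u := g')"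
    define a' where "a' w = (if w = u then b else a w - (blinfun_mult_right (a w u) o\<^sub>L b))" for w
    have "adapted_system (insert g F) X S (insert u W) e' a' (P + rank_one g' u)"
      unfolding adapted_system_def
    proof (intro conjI ballI allI)
      show "P + rank_one g' u \<in> operators s" by (intro operators_add P rank_one_operators g')
      show "e' w \<in> dual s" "a' w \<in> dual s" if "w \<in> insert u W" for w
        using that dual g' b by (auto simp: e'_def a'_def intro!: dual_diff dual_mult)
      show "e' w v = (if v = w then 1 else 0)" "a' w v = (if v = w then 1 else 0)"
        if "w \<in> insert u W" "v \<in> insert u W" for w v
        using that uW by (auto simp: e'_def a'_def eu g'w g'u e a b blinfun.bilinear_simps)
      show "a' w x = 0" if "w \<in> insert u W" "x \<in> X" for w x
        using that by (auto simp: a'_def b aX blinfun.bilinear_simps)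
      show "f ((P + rank_one g' u) x) = f x" if "f \<in> insert g F" for f x
        using update[OF that u_def v(2)] .
      show "(P + rank_one g' u) x = (\<Sum>w\<in>insert u W. s (e' w x) w)" if "x \<in> S" for x
      proof -
        have "(\<Sum>w\<in>W. s (e' w x) w) = (\<Sum>w\<in>W. s (e w x) w)"
          using uW by (intro sum.cong) (auto simp: e'_def)
        then show ?thesis
          using W uW PS[OF that] by (simp add: blinfun.add_left e'_def add.commute)
      qed
    qed (use W uS in auto)
    then show ?thesis by blast
  qed
qed

section \<open>Construction of the interpolating operator \<open>D\<close>\<close>

lemma exists_interpolating_G_set:
  assumes K: "absolutely_convex s K" and comp: "compact K" and inf: "infinite_dimensional s K"
    and T: "T \<in> A_alg s K" and F: "finite F" "F \<subseteq> dual s" and X: "finite X"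
  shows "\<exists>D\<in>G_set s K. \<forall>f\<in>F. \<forall>x\<in>X. blinfun_apply f (blinfun_apply D x) = f (T x)"
proof -
  have Top: "T \<in> operators s" and TV: "\<And>x. x \<in> closure (span K) \<Longrightarrow> T x \<in> closure (span K)"
    using T by (auto simp: A_alg_def V_space_def)
  have ne: "K \<noteq> {}" using infinite_dimensional_not_subset_span[OF inf, of "{}"] by auto
  obtain W e a P where "adapted_system F X (span K) W e a P"
    using adapted_system_exists[OF F X subspace_span infinite_dimensional_not_subset_span[OF inf]]
    by blast
  then have W: "finite W" "W \<subseteq> span K" and P: "P \<in> operators s"
    and dual: "\<And>w. w \<in> W \<Longrightarrow> e w \<in> dual s" "\<And>w. w \<in> W \<Longrightarrow> a w \<in> dual s"
    and e: "\<And>w v. w \<in> W \<Longrightarrow> v \<in> W \<Longrightarrow> e w v = (if v = w then 1 else 0)"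
    and a: "\<And>w v. w \<in> W \<Longrightarrow> v \<in> W \<Longrightarrow> a w v = (if v = w then 1 else 0)"
    and aX: "\<And>w x. w \<in> W \<Longrightarrow> x \<in> X \<Longrightarrow> a w x = 0"
    and FP: "\<And>f x. f \<in> F \<Longrightarrow> f (P x) = f x"
    and PS: "\<And>x. x \<in> span K \<Longrightarrow> P x = (\<Sum>w\<in>W. s (e w x) w)"
    unfolding adapted_system_def by auto
  \<comment> \<open>The formula extends by continuity to the closure, which is where
    \<open>T\<close> sends \<open>span K\<close>.\<close>
  have PV: "P x = (\<Sum>w\<in>W. s (e w x) w)" if "x \<in> closure (span K)" for x
  proof -
    have "closed {x. P x = (\<Sum>w\<in>W. rank_one (e w) w x)}"
      by (intro closed_Collect_eq continuous_intros)
    then have "closure (span K) \<subseteq> {x. P x = (\<Sum>w\<in>W. rank_one (e w) w x)}"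
      using PS by (intro closure_minimal) auto
    with that show ?thesis by auto
  qed
  have delta: "(\<Sum>v\<in>W. c v * (if v = w then 1 else 0)) = c w" if "w \<in> W" for c :: "'a \<Rightarrow> 'k" and w
    using W(1) that by (simp add: if_distrib cong: if_cong)
  \<comment> \<open>This is \<open>e w\<close> composed with \<open>T\<close>, corrected to vanish
    on \<open>W\<close>; with \<open>h\<close> below,
    \<open>e w (T x) + h w x = N * a w x + c w x\<close>.\<close>
  define c where "c w = (e w o\<^sub>L T) - (\<Sum>v\<in>W. blinfun_mult_right (e w (T v)) o\<^sub>L a v)" for w
  have c_apply: "c w x = e w (T x) - (\<Sum>v\<in>W. e w (T v) * a v x)" for w x
    by (simp add: c_def blinfun.bilinear_simps blinfun.sum_left)
  have cw: "c w v = 0" if "w \<in> W" "v \<in> W" for w v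
  proof -
    have "(\<Sum>u\<in>W. e w (T u) * a u v) = (\<Sum>u\<in>W. e w (T u) * (if u = v then 1 else 0))"
      using that a by (intro sum.cong) auto
    then show ?thesis using that delta by (simp add: c_apply)
  qed
  have cdual: "c w \<in> dual s" if "w \<in> W" for w
    unfolding c_def using that dual Top by (intro dual_diff dual_compose dual_sum dual_mult)
  have "\<exists>z r. z \<in> K \<and> r \<ge> 0 \<and> w = r *\<^sub>R z" if "w \<in> W" for w
    using absolutely_convex_span[OF K ne] W that by blast
  then obtain z r where zr: "\<And>w. w \<in> W \<Longrightarrow> z w \<in> K" "\<And>w. w \<in> W \<Longrightarrow> r w \<ge> 0"
    "\<And>w. w \<in> W \<Longrightarrow> w = r w *\<^sub>R z w"
    by metis
  obtain B where B: "B \<ge> 0" "\<And>k. k \<in> K \<Longrightarrow> norm k \<le> B"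
    using compact_imp_bounded[OF comp] ne unfolding bounded_iff
    by (metis all_not_in_conv norm_ge_zero order_trans)
  \<comment> \<open>A bound, independent of \<open>N\<close>, for the coefficients
    \<open>t w\<close> below. \<open>N\<close> is then chosen so that these use up weight at most
    \<open>(N - 1) / N\<close>, leaving \<open>1 / N\<close> for \<open>k\<close>.\<close>
  define C where "C w = (norm (a w) + norm (e w) + norm (c w)) * B" for w
  define N where "N = 1 + (\<Sum>w\<in>W. C w * r w)"
  have N: "N \<ge> 1" unfolding N_def C_def using zr B by (auto intro!: sum_nonneg)
  define h where "h w = N *\<^sub>R a w - (\<Sum>v\<in>W. blinfun_mult_right (e w (T v)) o\<^sub>L a v)" for w
  have h_apply: "h w x = of_real N * a w x - (\<Sum>v\<in>W. e w (T v) * a v x)" for w x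
    by (simp add: h_def blinfun.bilinear_simps blinfun.sum_left scaleR_conv_of_real)
  have hdual: "h w \<in> dual s" if "w \<in> W" for w
    unfolding h_def using that dual by (intro dual_diff dual_scaleR dual_sum dual_mult)
  define D where "D = N *\<^sub>R (id_blinfun - P) + (P o\<^sub>L T) + (\<Sum>w\<in>W. rank_one (h w) w)"
  have D_apply: "D x = N *\<^sub>R (x - P x) + P (T x) + (\<Sum>w\<in>W. s (h w x) w)" for x
    by (simp add: D_def blinfun.bilinear_simps blinfun.sum_left)
  have D: "D \<in> operators s"
    unfolding D_def using P Top hdual
    by (intro operators_add operators_scaleR operators_diff operators_id operators_compose
        operators_sum rank_one_operators)
  \<comment> \<open>Each \<open>h w\<close> vanishes on \<open>X\<close>, \<open>f\<close>
    annihilates \<open>x - P x\<close>, and \<open>f (P (T x)) = f (T x)\<close>.\<close>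
  have "f (D x) = f (T x)" if "f \<in> F" "x \<in> X" for f x
  proof -
    have "(\<Sum>w\<in>W. s (h w x) w) = 0" using that by (simp add: h_apply aX)
    then show ?thesis using that by (simp add: D_apply blinfun.bilinear_simps FP)
  qed
  moreover have "k \<in> D ` K" if k: "k \<in> K" for k
  proof
    \<comment> \<open>Obtained by solving \<open>N * a w x + c w x = e w k\<close> for
      \<open>t w\<close>, with \<open>x\<close> as below; \<open>c w\<close> vanishes on
      \<open>W\<close>, so \<open>t\<close> enters only through \<open>a w x\<close>.\<close>
    define t where "t w = a w k - e w k + c w k / of_real N" for w
    define x where "x = (1 / N) *\<^sub>R (k - (\<Sum>w\<in>W. s (t w) w))"
    have k_span: "k \<in> span K" using k by (rule span_base)
    have x_span: "x \<in> span K"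
      unfolding x_def scale_of_real[symmetric] using W k_span
      by (intro span_scale span_diff span_sum) auto
    have f_x: "f x = (f k - (\<Sum>w\<in>W. t w * f w)) / of_real N" if "f \<in> dual s" for f :: "'a \<Rightarrow>\<^sub>L 'k"
      by (simp add: x_def blinfun.bilinear_simps blinfun.sum_right dual_scale that
          scaleR_conv_of_real divide_simps)
    have e_x: "e w x = (e w k - t w) / of_real N" if "w \<in> W" for w
    proof -
      have "(\<Sum>v\<in>W. t v * e w v) = (\<Sum>v\<in>W. t v * (if v = w then 1 else 0))"
        using that e by (intro sum.cong) auto
      then show ?thesis using f_x dual that delta by simp
    qed
    have a_x: "a w x = (a w k - t w) / of_real N" if "w \<in> W" for w
    proof -
      have "(\<Sum>v\<in>W. t v * a w v) = (\<Sum>v\<in>W. t v * (if v = w then 1 else 0))"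
        using that a by (intro sum.cong) auto
      then show ?thesis using f_x dual that delta by simp
    qed
    have c_x: "c w x = c w k / of_real N" if "w \<in> W" for w
      using f_x[OF cdual[OF that]] cw[OF that] by simp
    have N0: "(of_real N :: 'k) \<noteq> 0" using N by simp
    have "e w (T x) + h w x = e w k" if "w \<in> W" for w
    proof -
      have "e w (T x) + h w x = of_real N * a w x + c w x" by (simp add: h_apply c_apply)
      also have "\<dots> = e w k" using that N0 by (simp add: a_x c_x t_def)
      finally show ?thesis .
    qed
    \<comment> \<open>This is the \<open>P k\<close> part of \<open>k\<close>; the term
      \<open>N *\<^sub>R (x - P x)\<close> supplies \<open>k - P k\<close>.\<close>
    then have low: "P (T x) + (\<Sum>w\<in>W. s (h w x) w) = (\<Sum>w\<in>W. s (e w k) w)"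
      using PV[OF TV[OF subsetD[OF closure_subset x_span]]]
      by (simp flip: sum.distrib scale_left_distrib)
    have "N *\<^sub>R P x = (\<Sum>w\<in>W. s (e w k - t w) w)"
      using N0 by (simp add: PS[OF x_span] scaleR_sum_right e_x flip: scale_of_real_mult)
    moreover have "N *\<^sub>R x = k - (\<Sum>w\<in>W. s (t w) w)" using N by (simp add: x_def)
    ultimately have "N *\<^sub>R (x - P x) = k - (\<Sum>w\<in>W. s (e w k) w)"
      by (simp add: scaleR_diff_right scale_left_diff_distrib sum_subtractf)
    with low show "k = D x" by (simp add: D_apply add.assoc)
    have t_bound: "norm (t w) \<le> C w" if "w \<in> W" for w
    proof -
      have bound: "norm (f k) \<le> norm f * B" for f :: "'a \<Rightarrow>\<^sub>L 'k"
        using norm_blinfun[of f k] B(2)[OF k] by (meson mult_left_mono norm_ge_zero order_trans)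
      \<comment> \<open>Since \<open>N \<ge> 1\<close>, the dependence of \<open>t\<close> on
        \<open>N\<close> disappears from the bound.\<close>
      have "norm (c w k / of_real N) \<le> norm (c w k)"
        using N by (simp add: norm_divide divide_le_eq mult_le_cancel_left1)
      then have "norm (t w) \<le> norm (a w k) + norm (e w k) + norm (c w k)"
        unfolding t_def
        by (smt (verit) norm_triangle_ineq norm_triangle_ineq4)
      also have "\<dots> \<le> C w" unfolding C_def distrib_right by (intro add_mono bound)
      finally show ?thesis .
    qed
    \<comment> \<open>Coefficients of \<open>x\<close> after each \<open>w\<close> is replaced by
      \<open>r w *\<^sub>R z w\<close> with \<open>z w\<close> in \<open>K\<close>.\<close>
    define d where "d w = of_real (- r w / N) * t w" for w
    have "(\<Sum>w\<in>W. s (d w) (z w)) = (\<Sum>w\<in>W. - ((1 / N) *\<^sub>R s (t w) w))"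
    proof (rule sum.cong)
      fix w assume w: "w \<in> W"
      have "s (t w) w = r w *\<^sub>R s (t w) (z w)" using zr(3)[OF w] scale_scaleR by metis
      then show "s (d w) (z w) = - ((1 / N) *\<^sub>R s (t w) w)"
        unfolding d_def scale_of_real_mult by simp
    qed simp
    then have x_eq: "x = (1 / N) *\<^sub>R k + (\<Sum>w\<in>W. s (d w) (z w))"
      by (simp add: x_def scaleR_diff_right scaleR_sum_right sum_negf)
    have "(\<Sum>w\<in>W. norm (d w)) \<le> (\<Sum>w\<in>W. C w * r w / N)"
    proof (rule sum_mono)
      fix w assume w: "w \<in> W"
      have "norm (d w) = norm (t w) * r w / N"
        using N zr(2)[OF w] by (simp add: d_def norm_mult norm_divide abs_if)
      also have "\<dots> \<le> C w * r w / N"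
        using N zr(2)[OF w] t_bound[OF w] by (intro divide_right_mono mult_right_mono) auto
      finally show "norm (d w) \<le> C w * r w / N" .
    qed
    then have "1 / N + (\<Sum>w\<in>W. norm (d w)) \<le> 1 / N + (N - 1) / N"
      by (simp add: N_def flip: sum_divide_distrib)
    also have "\<dots> = 1" using N by (simp add: field_simps)
    finally have le1: "1 / N + (\<Sum>w\<in>W. norm (d w)) \<le> 1" .
    obtain q where "q \<in> K" "x = (1 / N + (\<Sum>w\<in>W. norm (d w))) *\<^sub>R q"
      using absolutely_convex_sum[OF K W(1) k, of z "1 / N" d] zr(1) N unfolding x_eq by auto
    with le1 N show "x \<in> K"
      by (auto intro!: absolutely_convex_shrink[OF K] add_nonneg_nonneg sum_nonneg)
  qed
  ultimately show ?thesis using D unfolding G_set_def by blast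
qed

section \<open>Passage to the weak operator closure\<close>

lemma A_alg_subset_WG_set:
  assumes "absolutely_convex s K" "compact K" "infinite_dimensional s K"
  shows "A_alg s K \<subseteq> WG_set s K"
proof
  fix T assume T: "T \<in> A_alg s K"
  have "G_set s K \<subseteq> operators s" by (auto simp: G_set_def)
  then have GI: "G_set s K \<inter> operators s = G_set s K" by blast
  show "T \<in> WG_set s K"
    unfolding WG_set_def
    by (rule in_WOT_closure_of)
      (use T exists_interpolating_G_set[OF assms T] in \<open>auto simp: GI A_alg_def\<close>)
qed

end

theorem theorem2p1:
  fixes s :: "complex \<Rightarrow> 'a::banach \<Rightarrow> 'a" and K :: "'a set"
  shows
    "(absolutely_convex (scaleR :: real \<Rightarrow> 'a \<Rightarrow> 'a) K \<and> compact K \<and>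
        infinite_dimensional (scaleR :: real \<Rightarrow> 'a \<Rightarrow> 'a) K
      \<longrightarrow> A_alg (scaleR :: real \<Rightarrow> 'a \<Rightarrow> 'a) K \<subseteq> WG_set scaleR K) \<and>
     (banach_space_over s \<and> absolutely_convex s K \<and> compact K \<and> infinite_dimensional s K
      \<longrightarrow> A_alg s K \<subseteq> WG_set s K)"
  using separating_dual.A_alg_subset_WG_set[OF separating_dual_real, of K]
    separating_dual.A_alg_subset_WG_set[OF separating_dual_complex, of s K]
  by blast

end
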